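(* Let $T$ be a finite tree with $m\ge 3$ leaves, and let $T'$ be the subgraph of $T$ induced by the non-leaf vertices. If $\Delta(T)=m$, then $\chi'_L(T)=m$. If $\Delta(T)<m$, then $\chi'_L(T)\le \Delta(T')+m$.
   Context: A leaf is a vertex of degree $1$; $\Delta(\cdot)$ is the maximum degree. For a proper edge coloring $c:E(G)\to\{1,\dots,k\}$ of a connected graph $G$, let $\pi=(\mathcal{C}_1,\dots,\mathcal{C}_k)$ be the ordered partition of $E(G)$ into color classes. For a vertex $v$ and an edge $e=xy$, $d(v,e)=\min\{d(v,x),d(v,y)\}$, and $d(v,\mathcal{C}_i)=\min\{d(v,e): e\in\mathcal{C}_i\}$. The edge color code of $v$ is $c_\pi(v)=(d(v,\mathcal{C}_1),\dots,d(v,\mathcal{C}_k))$. The coloring is an edge-locating coloring if distinct vertices have distinct edge color codes; $\chi'_L(G)$ is the minimum number of colors in an edge-locating coloring of $G$. *)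

theory Defs
  imports Main "HOL-Library.Extended_Nat"
begin

datatype 'a ugraph = UGraph (vertices: "'a set") (edges: "'a set set")

definition finite_simple_graph :: "'a ugraph \<Rightarrow> bool" where
  "finite_simple_graph G \<longleftrightarrow>
     finite (vertices G) \<and> (\<forall>e\<in>edges G. e \<subseteq> vertices G \<and> card e = 2)"

definition walk :: "'a ugraph \<Rightarrow> 'a list \<Rightarrow> bool" where
  "walk G p \<longleftrightarrow>
     p \<noteq> [] \<and> set p \<subseteq> vertices G \<and> successively (\<lambda>x y. {x, y} \<in> edges G) p"

definition walk_between :: "'a ugraph \<Rightarrow> 'a \<Rightarrow> 'a list \<Rightarrow> 'a \<Rightarrow> bool" where
  "walk_between G u p v \<longleftrightarrow> walk G p \<and> hd p = u \<and> last p = v"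

definition connected_graph :: "'a ugraph \<Rightarrow> bool" where
  "connected_graph G \<longleftrightarrow>
     vertices G \<noteq> {} \<and> (\<forall>u\<in>vertices G. \<forall>v\<in>vertices G. \<exists>p. walk_between G u p v)"

text \<open>A cycle is listed without repeating its first vertex at the end.\<close>

definition is_cycle :: "'a ugraph \<Rightarrow> 'a list \<Rightarrow> bool" where
  "is_cycle G p \<longleftrightarrow>
     walk G p \<and> 3 \<le> length p \<and> distinct p \<and> {last p, hd p} \<in> edges G"

definition finite_tree :: "'a ugraph \<Rightarrow> bool" where
  "finite_tree G \<longleftrightarrow>
     finite_simple_graph G \<and> connected_graph G \<and> (\<nexists>p. is_cycle G p)"

definition vertex_degree :: "'a ugraph \<Rightarrow> 'a \<Rightarrow> nat" where
  "vertex_degree G v = card {e \<in> edges G. v \<in> e}"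

definition max_degree :: "'a ugraph \<Rightarrow> nat" where
  "max_degree G = Max (vertex_degree G ` vertices G)"

definition leaf_set :: "'a ugraph \<Rightarrow> 'a set" where
  "leaf_set G = {v \<in> vertices G. vertex_degree G v = 1}"

definition induced_subgraph :: "'a ugraph \<Rightarrow> 'a set \<Rightarrow> 'a ugraph" where
  "induced_subgraph G S = UGraph S {e \<in> edges G. e \<subseteq> S}"

text \<open>
  The number of edges on a shortest walk. It is only meaningful when \<open>v\<close> is reachable
  from \<open>u\<close>; below it is used in connected graphs only.
\<close>

definition graph_dist :: "'a ugraph \<Rightarrow> 'a \<Rightarrow> 'a \<Rightarrow> nat" where
  "graph_dist G u v = (LEAST n. \<exists>p. walk_between G u p v \<and> length p = Suc n)"

definition edge_dist :: "'a ugraph \<Rightarrow> 'a \<Rightarrow> 'a set \<Rightarrow> nat" where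
  "edge_dist G v e = Min (graph_dist G v ` e)"

definition edge_set_dist :: "'a ugraph \<Rightarrow> 'a \<Rightarrow> 'a set set \<Rightarrow> nat" where
  "edge_set_dist G v C = Min (edge_dist G v ` C)"

text \<open>
  Every colour \<open>1, \<dots>, k\<close> has to occur: the colour classes form a partition
  of the edge set, and the distance to an empty class would be undefined.
\<close>

definition proper_edge_coloring :: "'a ugraph \<Rightarrow> nat \<Rightarrow> ('a set \<Rightarrow> nat) \<Rightarrow> bool" where
  "proper_edge_coloring G k c \<longleftrightarrow>
     c ` edges G = {1..k} \<and>
     (\<forall>e\<in>edges G. \<forall>f\<in>edges G. e \<noteq> f \<and> e \<inter> f \<noteq> {} \<longrightarrow> c e \<noteq> c f)"

definition color_class :: "'a ugraph \<Rightarrow> ('a set \<Rightarrow> nat) \<Rightarrow> nat \<Rightarrow> 'a set set" where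
  "color_class G c i = {e \<in> edges G. c e = i}"

definition edge_color_code :: "'a ugraph \<Rightarrow> nat \<Rightarrow> ('a set \<Rightarrow> nat) \<Rightarrow> 'a \<Rightarrow> nat list" where
  "edge_color_code G k c v =
     map (\<lambda>i. edge_set_dist G v (color_class G c i)) [1..<Suc k]"

definition edge_locating_coloring :: "'a ugraph \<Rightarrow> nat \<Rightarrow> ('a set \<Rightarrow> nat) \<Rightarrow> bool" where
  "edge_locating_coloring G k c \<longleftrightarrow>
     proper_edge_coloring G k c \<and> inj_on (edge_color_code G k c) (vertices G)"

text \<open>
  The value is \<open>\<infinity>\<close> if there is no edge-locating coloring at all, as for the graph with
  two adjacent vertices.
\<close>

definition edge_locating_chromatic_number :: "'a ugraph \<Rightarrow> enat" where
  "edge_locating_chromatic_number G =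
     (INF k \<in> {k. \<exists>c. edge_locating_coloring G k c}. enat k)"

end

theory Submission
  imports Defs
begin

text \<open>
  Every vertex other than the root of a tree has leaves below it. If \<open>\<Delta>(T) = m\<close>, root \<open>T\<close> at
  a vertex of degree \<open>m\<close>: each of the \<open>m\<close> branches contains exactly one leaf, so \<open>T\<close> is a
  spider. Colour leg \<open>i\<close> alternately with \<open>i\<close> and \<open>i + 1\<close> modulo \<open>m\<close>, starting with \<open>i\<close> at
  the centre. Since \<open>m \<ge> 3\<close>, the positions of the entries 0 and 1 of a code determine the leg,
  and the entries outside the colour pair of the leg are the distance to the centre.

  In general, give the \<open>m\<close> leaf edges private colours and colour the edges of \<open>T'\<close> greedily
  from the root with \<open>\<Delta>(T')\<close> further colours. The leaf edges alone already resolve the vertices: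
  for non-leaves \<open>u \<noteq> v\<close>, extend the path from \<open>v\<close> to \<open>u\<close> to a leaf.
\<close>

lemma walk_between_Nil [simp]: "\<not> walk_between G u [] v"
  by (simp add: walk_between_def walk_def)

section \<open>Neighbours and degrees in a finite tree\<close>

locale tree_graph =
  fixes T :: "'a ugraph"
  assumes tree: "finite_tree T"
begin

abbreviation "V \<equiv> vertices T"
abbreviation "E \<equiv> edges T"
abbreviation "d \<equiv> graph_dist T"
abbreviation "L \<equiv> leaf_set T"

definition nbrs :: "'a \<Rightarrow> 'a set" where
  "nbrs v = {x. {x, v} \<in> E}"

lemma simple: "finite_simple_graph T" and connected: "connected_graph T"
  and acyclic: "\<not> is_cycle T p"
  using tree by (auto simp: finite_tree_def)

lemma finite_V [simp]: "finite V"
  using simple by (simp add: finite_simple_graph_def)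

lemma finite_E [simp]: "finite E"
  using simple finite_subset[of E "Pow V"] by (auto simp: finite_simple_graph_def)

lemma adjD:
  assumes "{x, y} \<in> E"
  shows "x \<in> V" "y \<in> V" "x \<noteq> y"
proof -
  have "{x, y} \<subseteq> V" "card {x, y} = 2"
    using simple assms by (auto simp: finite_simple_graph_def)
  then show "x \<in> V" "y \<in> V" "x \<noteq> y" by auto
qed

lemma edgeE:
  assumes "e \<in> E"
  obtains x y where "e = {x, y}" "x \<noteq> y"
  using simple assms by (metis card_2_iff finite_simple_graph_def)

lemma finite_nbrs [simp]: "finite (nbrs v)"
  by (rule finite_subset[of _ V]) (auto simp: nbrs_def adjD)

lemma vertex_degree_nbrs: "vertex_degree T v = card (nbrs v)"
proof -
  have "bij_betw (\<lambda>x. {x, v}) (nbrs v) {e \<in> E. v \<in> e}"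
    unfolding bij_betw_def
  proof
    show "inj_on (\<lambda>x. {x, v}) (nbrs v)"
      by (auto simp: inj_on_def doubleton_eq_iff)
    show "(\<lambda>x. {x, v}) ` nbrs v = {e \<in> E. v \<in> e}"
    proof
      show "{e \<in> E. v \<in> e} \<subseteq> (\<lambda>x. {x, v}) ` nbrs v"
      proof
        fix e assume e: "e \<in> {e \<in> E. v \<in> e}"
        then obtain x y where "e = {x, y}" "x \<noteq> y" by (auto elim: edgeE)
        with e show "e \<in> (\<lambda>x. {x, v}) ` nbrs v"
          by (auto simp: nbrs_def insert_commute)
      qed
    qed (auto simp: nbrs_def)
  qed
  then show ?thesis
    unfolding vertex_degree_def by (simp add: bij_betw_same_card)
qed

lemma leaf_iff: "v \<in> L \<longleftrightarrow> v \<in> V \<and> card (nbrs v) = 1"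
  by (auto simp: leaf_set_def vertex_degree_nbrs)

lemma leaf_V: "l \<in> L \<Longrightarrow> l \<in> V"
  by (simp add: leaf_iff)

lemma finite_L [simp]: "finite L"
  by (rule finite_subset[of _ V]) (auto simp: leaf_V)

subsection \<open>Distances\<close>

lemma dist_walk:
  assumes "u \<in> V" "v \<in> V"
  obtains p where "walk_between T u p v" "length p = Suc (d u v)"
proof -
  obtain q where q: "walk_between T u q v"
    using connected assms by (auto simp: connected_graph_def)
  then have "length q = Suc (length q - 1)" by (cases q) auto
  with q have "\<exists>n p. walk_between T u p v \<and> length p = Suc n" by blast
  from LeastI_ex[OF this] that show ?thesis
    by (auto simp: graph_dist_def)
qed

lemma dist_le_walk:
  assumes "walk_between T u p v"
  shows "d u v \<le> length p - 1"
proof -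
  have "length p = Suc (length p - 1)" using assms by (cases p) auto
  with assms show ?thesis unfolding graph_dist_def by (intro Least_le) blast
qed

lemma dist_self [simp]: "u \<in> V \<Longrightarrow> d u u = 0"
  using dist_le_walk[of u "[u]" u] by (auto simp: walk_between_def walk_def)

lemma dist_eq_0_iff:
  assumes "u \<in> V" "v \<in> V"
  shows "d u v = 0 \<longleftrightarrow> u = v"
proof
  assume "d u v = 0"
  with dist_walk[OF assms] obtain p where p: "walk_between T u p v" "length p = Suc 0"
    by metis
  then obtain a where "p = [a]" by (auto simp: length_Suc_conv)
  with p show "u = v" by (auto simp: walk_between_def)
qed (use assms in simp)

lemma dist_le_sym:
  assumes "u \<in> V" "v \<in> V"
  shows "d v u \<le> d u v"
proof -
  obtain p where p: "walk_between T u p v" "length p = Suc (d u v)"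
    using dist_walk[OF assms] .
  have "walk_between T v (rev p) u"
    using p by (auto simp: walk_between_def walk_def hd_rev last_rev insert_commute)
  from dist_le_walk[OF this] p show ?thesis by simp
qed

lemma dist_sym: "u \<in> V \<Longrightarrow> v \<in> V \<Longrightarrow> d u v = d v u"
  by (simp add: dist_le_sym le_antisym)

lemma dist_triangle:
  assumes "u \<in> V" "v \<in> V" "w \<in> V"
  shows "d u w \<le> d u v + d v w"
proof -
  obtain p where p: "walk_between T u p v" "length p = Suc (d u v)"
    using dist_walk assms by metis
  obtain q where q: "walk_between T v q w" "length q = Suc (d v w)"
    using dist_walk assms by metis
  then obtain q' where q': "q = v # q'"
    by (cases q) (auto simp: walk_between_def)
  have "walk_between T u (p @ q') w"
    using p q q'
    by (cases q') (auto simp: walk_between_def walk_def successively_append_iff)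
  from dist_le_walk[OF this] p q q' show ?thesis by simp
qed

lemma dist_adj:
  assumes "{x, y} \<in> E"
  shows "d x y = 1"
proof -
  have "walk_between T x [x, y] y"
    using adjD[OF assms] assms by (simp add: walk_between_def walk_def)
  from dist_le_walk[OF this] have "d x y \<le> 1" by simp
  moreover have "d x y \<noteq> 0" using adjD[OF assms] dist_eq_0_iff by blast
  ultimately show ?thesis by simp
qed

lemma dist_adj_le: "u \<in> V \<Longrightarrow> {x, y} \<in> E \<Longrightarrow> d u y \<le> Suc (d u x)"
  using dist_triangle[of u x y] by (simp add: dist_adj adjD)

lemma closer_nbr:
  assumes "u \<in> V" "v \<in> V" "d u v = Suc n"
  obtains x where "{x, v} \<in> E" "d u x = n"
proof -
  obtain p where p: "walk_between T u p v" "length p = Suc (Suc n)"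
    using dist_walk assms by metis
  then obtain q where q: "p = q @ [v]" "length q = Suc n"
    by (cases p rule: rev_cases) (auto simp: walk_between_def)
  then have "q \<noteq> []" by auto
  have adj: "{last q, v} \<in> E" and "walk_between T u q (last q)"
    using p q \<open>q \<noteq> []\<close> by (auto simp: walk_between_def walk_def successively_append_iff)
  from dist_le_walk[OF this(2)] q have "d u (last q) \<le> n" by simp
  with dist_adj_le[OF assms(1) adj] assms(3) adj that show ?thesis by simp
qed

text \<open>A lower bound for distances: a potential that grows by at most 1 along each edge grows
  by at most the length of a shortest path. Its values are integers because the potential used for
  spiders can become negative.\<close>

lemma lipschitz_le_dist:
  fixes f :: "'a \<Rightarrow> int"
  assumes f: "\<And>x y. {x, y} \<in> E \<Longrightarrow> f y \<le> f x + 1"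
    and "u \<in> V" "v \<in> V"
  shows "f v \<le> f u + int (d u v)"
proof -
  have "f v \<le> f u + int n" if "v \<in> V" "d u v = n" for n v
    using that
  proof (induction n arbitrary: v)
    case 0
    then show ?case using dist_eq_0_iff assms by auto
  next
    case (Suc n)
    obtain x where x: "{x, v} \<in> E" "d u x = n"
      using closer_nbr Suc.prems assms by metis
    with Suc.IH[of x] f[OF x(1)] show ?case by (simp add: adjD)
  qed
  with assms show ?thesis by simp
qed

text \<open>Otherwise \<open>x\<close> and \<open>y\<close> both reach \<open>r\<close> without
  meeting \<open>w\<close>, so a path avoiding \<open>w\<close> joins them, and \<open>w\<close>
  closes it to a cycle. Allowing equal depths excludes edges within a level as well as a second
  parent.\<close>

lemma unique_closer_nbr:
  assumes r: "r \<in> V" and x: "{x, w} \<in> E" "d r x \<le> d r w"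
    and y: "{y, w} \<in> E" "d r y \<le> d r w"
  shows "x = y"
proof (rule ccontr)
  assume "x \<noteq> y"
  \<comment> \<open>Adjacency in \<open>T\<close> with \<open>w\<close> deleted. From a vertex other
    than \<open>w\<close> that is no deeper than \<open>w\<close>, each step towards
    \<open>r\<close> leads to a depth below that of \<open>w\<close>, so it stays in
    \<open>R\<close>.\<close>
  define R where "R = {(a, b). {a, b} \<in> E \<and> a \<noteq> w \<and> b \<noteq> w}"
  have to_root: "(z, r) \<in> R\<^sup>*" if "z \<in> V" "z \<noteq> w" "d r z \<le> d r w" "d r z = n" for z n
    using that
  proof (induction n arbitrary: z)
    case 0
    then show ?case using dist_eq_0_iff r by auto
  next
    case (Suc n)
    obtain a where a: "{a, z} \<in> E" "d r a = n"
      using closer_nbr Suc.prems r by metis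
    with Suc.prems have "a \<noteq> w" by auto
    with a Suc.prems have "(z, a) \<in> R" by (simp add: R_def insert_commute)
    moreover have "(a, r) \<in> R\<^sup>*"
      using Suc.IH[of a] Suc.prems a \<open>a \<noteq> w\<close> by (simp add: adjD)
    ultimately show ?case by (rule converse_rtrancl_into_rtrancl)
  qed
  have "sym R" by (auto simp: R_def sym_def insert_commute)
  have "(x, r) \<in> R\<^sup>*" "(y, r) \<in> R\<^sup>*"
    using to_root x y adjD by metis+
  with \<open>sym R\<close> have "(x, y) \<in> R\<^sup>*"
    by (meson rtrancl_trans sym_rtrancl symD)
  \<comment> \<open>The walk is kept free of repetitions while it grows: a step to a vertex already
    on the path truncates the path there.\<close>
  then have "\<exists>p. walk_between T x p y \<and> distinct p \<and> w \<notin> set p"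
  proof (induction rule: rtrancl_induct)
    case base
    have "walk_between T x [x] x" "w \<notin> set [x]" "distinct [x]"
      using adjD[OF x(1)] by (auto simp: walk_between_def walk_def)
    then show ?case by blast
  next
    case (step b z)
    then obtain p where p: "walk_between T x p b" "distinct p" "w \<notin> set p" by blast
    from step have bz: "{b, z} \<in> E" "z \<noteq> w" by (auto simp: R_def)
    show ?case
    proof (cases "z \<in> set p")
      case True
      then obtain p1 p2 where p12: "p = p1 @ z # p2" by (auto simp: in_set_conv_decomp)
      with p have "successively (\<lambda>x y. {x, y} \<in> E) ((p1 @ [z]) @ p2)"
        by (simp add: walk_between_def walk_def)
      then have "successively (\<lambda>x y. {x, y} \<in> E) (p1 @ [z])"
        unfolding successively_append_iff[of _ "p1 @ [z]"] by blast
      with p p12 have "walk_between T x (p1 @ [z]) z"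
        by (cases p1) (auto simp: walk_between_def walk_def)
      moreover have "distinct (p1 @ [z])" "w \<notin> set (p1 @ [z])"
        using p p12 by auto
      ultimately show ?thesis by blast
    next
      case False
      with p bz adjD[OF bz(1)] have "walk_between T x (p @ [z]) z"
        by (auto simp: walk_between_def walk_def successively_append_iff)
      moreover have "distinct (p @ [z])" "w \<notin> set (p @ [z])"
        using p bz False by auto
      ultimately show ?thesis by blast
    qed
  qed
  then obtain p where p: "walk_between T x p y" "distinct p" "w \<notin> set p" by blast
  \<comment> \<open>Distinct ends give \<open>p\<close> at least two vertices, so
    \<open>w # p\<close> has the three vertices that a cycle needs.\<close>
  obtain a b q where q: "p = a # b # q"
    using p \<open>x \<noteq> y\<close> by (cases p; cases "tl p") (auto simp: walk_between_def walk_def)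
  have "is_cycle T (w # p)"
    using p q x y adjD[OF x(1)]
    by (auto simp: is_cycle_def walk_between_def walk_def insert_commute)
  with acyclic show False by blast
qed

end

subsection \<open>Rooted trees\<close>

locale rooted_tree = tree_graph +
  fixes r :: 'a
  assumes root: "r \<in> V"
begin

definition par :: "'a \<Rightarrow> 'a" where
  "par v = (SOME x. {x, v} \<in> E \<and> Suc (d r x) = d r v)"

lemma par:
  assumes "v \<in> V" "v \<noteq> r"
  shows par_edge: "{par v, v} \<in> E" and par_depth: "Suc (d r (par v)) = d r v"
    and par_V: "par v \<in> V"
proof -
  have "d r v \<noteq> 0" using assms root dist_eq_0_iff by blast
  then obtain n where "d r v = Suc n" using not0_implies_Suc by blast
  with closer_nbr[OF root assms(1)] have "\<exists>x. {x, v} \<in> E \<and> Suc (d r x) = d r v" by metis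
  from someI_ex[OF this] show "{par v, v} \<in> E" "Suc (d r (par v)) = d r v"
    by (auto simp: par_def)
  then show "par v \<in> V" using adjD by blast
qed

text \<open>The end nearer to \<open>r\<close> and the parent of the other end both qualify in
  \<open>unique_closer_nbr\<close>, so they coincide.\<close>

lemma adj_cases:
  assumes "{x, y} \<in> E"
  obtains "x \<noteq> r" "y = par x" | "y \<noteq> r" "x = par y"
proof -
  have le: "y \<noteq> r \<and> x = par y" if "{x, y} \<in> E" "d r x \<le> d r y" for x y
  proof -
    have "y \<noteq> r"
      using that root adjD[OF that(1)] dist_eq_0_iff[of r x] by auto
    moreover from this have "x = par y"
      using unique_closer_nbr[OF root that] par[of y] adjD[OF that(1)] by auto
    ultimately show ?thesis by blast
  qed
  have "{y, x} \<in> E" using assms by (simp add: insert_commute)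
  with le[of x y] le[of y x] assms that show ?thesis by (meson nat_le_linear)
qed

text \<open>Names each edge by its lower end, which turns edge colourings into functions on the
  vertices other than \<open>r\<close>.\<close>

definition up :: "'a \<Rightarrow> 'a set" where
  "up x = {par x, x}"

lemma inj_on_up: "inj_on up (V - {r})"
proof (rule inj_onI)
  fix x y assume xy: "x \<in> V - {r}" "y \<in> V - {r}" "up x = up y"
  show "x = y"
  proof (rule ccontr)
    assume "x \<noteq> y"
    with xy have "par x = y" "par y = x" by (auto simp: up_def doubleton_eq_iff)
    with par_depth[of x] par_depth[of y] xy show False by auto
  qed
qed

lemma edges_eq_up: "E = up ` (V - {r})"
proof
  show "E \<subseteq> up ` (V - {r})"
  proof
    fix e assume "e \<in> E"
    moreover from this obtain x y where "e = {x, y}" by (auto elim: edgeE)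
    ultimately have e: "{x, y} \<in> E" "e = {x, y}" by auto
    from e(1) show "e \<in> up ` (V - {r})"
    proof (cases rule: adj_cases)
      case 1
      with e adjD[OF e(1)] show ?thesis by (auto simp: up_def)
    next
      case 2
      with e adjD[OF e(1)] show ?thesis by (auto simp: up_def)
    qed
  qed
qed (use par_edge in \<open>auto simp: up_def\<close>)

definition low :: "'a set \<Rightarrow> 'a" where
  "low = inv_into (V - {r}) up"

lemma low_up [simp]: "x \<in> V \<Longrightarrow> x \<noteq> r \<Longrightarrow> low (up x) = x"
  by (simp add: low_def inv_into_f_f[OF inj_on_up])

lemma edge_upE:
  assumes "e \<in> E"
  obtains x where "x \<in> V" "x \<noteq> r" "e = up x" "low e = x"
  using assms low_up by (auto simp: edges_eq_up)

lemma up_edge: "x \<in> V \<Longrightarrow> x \<noteq> r \<Longrightarrow> up x \<in> E"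
  by (auto simp: edges_eq_up)

definition children :: "'a \<Rightarrow> 'a set" where
  "children v = {x \<in> V. x \<noteq> r \<and> par x = v}"

lemma finite_children [simp]: "finite (children v)"
  by (simp add: children_def)

lemma nbrs_eq:
  assumes "v \<in> V"
  shows "nbrs v = (if v = r then children v else insert (par v) (children v))"
proof -
  have "x = par v \<and> v \<noteq> r \<or> x \<in> children v" if "{x, v} \<in> E" for x
    using that adjD[OF that] by (cases rule: adj_cases[OF that]) (auto simp: children_def)
  moreover have "{x, v} \<in> E" if "x \<in> children v" for x
    using that par_edge[of x] by (auto simp: children_def insert_commute)
  ultimately show ?thesis
    using par_edge[of v] assms unfolding nbrs_def by auto
qed

lemma par_notin_children:
  assumes "v \<in> V" "v \<noteq> r"
  shows "par v \<notin> children v"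
proof
  assume "par v \<in> children v"
  then have "Suc (d r v) = d r (par v)" using par_depth[of "par v"] by (auto simp: children_def)
  with par_depth[OF assms] show False by simp
qed

lemma card_nbrs:
  assumes "v \<in> V"
  shows "card (nbrs v) = card (children v) + (if v = r then 0 else 1)"
  using assms by (simp add: nbrs_eq par_notin_children)

lemma leaf_iff_children:
  assumes "v \<in> V" "v \<noteq> r"
  shows "v \<in> L \<longleftrightarrow> children v = {}"
  using assms by (simp add: leaf_iff card_nbrs)

lemma edge_at_cases:
  assumes "e \<in> E" "v \<in> e"
  obtains "v \<in> V" "v \<noteq> r" "e = up v" | x where "x \<in> children v" "e = up x"
  using assms by (auto simp: edges_eq_up up_def children_def)

text \<open>The edges at \<open>v\<close> are \<open>up v\<close> and the edges to its children, so
  only parent-child and sibling pairs have to be compared. The root names no edge, hence the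
  restriction \<open>par x \<noteq> r\<close>.\<close>

lemma proper_by_lower_end:
  fixes C :: "'a \<Rightarrow> 'b"
  assumes vert: "\<And>x. x \<in> V \<Longrightarrow> x \<noteq> r \<Longrightarrow> par x \<noteq> r \<Longrightarrow> C x \<noteq> C (par x)"
    and sib: "\<And>v. inj_on C (children v)"
    and e: "e \<in> E" and f: "f \<in> E" "e \<noteq> f" "e \<inter> f \<noteq> {}"
  shows "C (low e) \<noteq> C (low f)"
proof -
  obtain v where v: "v \<in> e" "v \<in> f" using f by blast
  have low_child: "low (up x) = x" "C x \<noteq> C v" if "x \<in> children v" "v \<noteq> r" for x
    using that vert[of x] by (auto simp: children_def)
  have low_child': "low (up x) = x" if "x \<in> children v" for x
    using that by (auto simp: children_def)
  from e v(1) show ?thesis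
  proof (cases rule: edge_at_cases)
    case 1
    from f(1) v(2) show ?thesis
    proof (cases rule: edge_at_cases)
      case (2 x)
      with 1 low_child[of x] show ?thesis by force
    qed (use 1 f in simp)
  next
    case (2 x)
    from f(1) v(2) show ?thesis
    proof (cases rule: edge_at_cases)
      case 1
      with 2 low_child show ?thesis by auto
    next
      case (2 y)
      with \<open>x \<in> children v\<close> \<open>e = up x\<close> f low_child' sib[of v] show ?thesis
        by (auto simp: inj_on_def)
    qed
  qed
qed

section \<open>Ancestors, and leaves below a vertex\<close>

lemma anc_dist:
  assumes "l \<in> V" "k \<le> d r l"
  shows "(par ^^ k) l \<in> V \<and> d r ((par ^^ k) l) = d r l - k \<and> d ((par ^^ k) l) l \<le> k"
  using assms(2)
proof (induction k)
  case 0
  with assms show ?case by simp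
next
  case (Suc k)
  define w where "w = (par ^^ k) l"
  have w: "w \<in> V" "d r w = d r l - k" "d w l \<le> k" using Suc by (auto simp: w_def)
  with Suc.prems root have "w \<noteq> r" by auto
  note p = par[OF w(1) this]
  have "d (par w) l \<le> d (par w) w + d w l"
    using p w assms by (intro dist_triangle) auto
  with p w dist_adj[OF p(1)] show ?case by (simp add: w_def)
qed

text \<open>A descendant of \<open>v\<close> of greatest depth has no children.\<close>

lemma leaf_below:
  assumes v: "v \<in> V" "v \<noteq> r"
  obtains l where "l \<in> L" "d r v \<le> d r l" "(par ^^ (d r l - d r v)) l = v"
proof -
  \<comment> \<open>The descendants of \<open>v\<close>, including \<open>v\<close> itself.\<close>
  define D where "D = {l \<in> V. d r v \<le> d r l \<and> (par ^^ (d r l - d r v)) l = v}"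
  have "finite D" "v \<in> D" using v by (auto simp: D_def)
  then have "Max (d r ` D) \<in> d r ` D" by (intro Max_in) auto
  then obtain l where "l \<in> D" "Max (d r ` D) = d r l" by auto
  with \<open>finite D\<close> have l: "l \<in> D" "\<forall>x\<in>D. d r x \<le> d r l"
    using Max_ge[of "d r ` D"] by auto
  have "d r v \<noteq> 0" using v root dist_eq_0_iff by blast
  \<comment> \<open>Having no children characterizes leaves only away from the root.\<close>
  then have "l \<noteq> r" using l root by (auto simp: D_def)
  have "l \<in> L"
  proof (rule ccontr)
    assume "l \<notin> L"
    then obtain x where "x \<in> children l"
      using leaf_iff_children[of l] l \<open>l \<noteq> r\<close> by (auto simp: D_def)
    then have x: "x \<in> V" "par x = l" "Suc (d r l) = d r x"
      using par_depth[of x] by (auto simp: children_def)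
    with l(1) have "Suc (d r l - d r v) = d r x - d r v" by (auto simp: D_def)
    moreover have "(par ^^ Suc (d r l - d r v)) x = v"
      using x l(1) by (simp only: funpow_Suc_right o_apply D_def mem_Collect_eq)
    ultimately have "x \<in> D" using x l(1) by (auto simp: D_def)
    with l x show False by auto
  qed
  with l that show ?thesis by (auto simp: D_def)
qed

end


subsection \<open>Resolving vertices by leaf edges\<close>

context tree_graph
begin

text \<open>Root the tree at \<open>v\<close> and take a leaf below \<open>u\<close>: the climb from
  the leaf to \<open>v\<close> passes through \<open>u\<close>. This bounds \<open>d u l\<close>
  from above, and the triangle inequality does the rest.\<close>

lemma leaf_between:
  assumes "u \<in> V" "v \<in> V" "u \<noteq> v"
  obtains l where "l \<in> L" "d v l = d v u + d u l"
proof -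
  interpret rooted_tree T v by unfold_locales (rule assms)
  obtain l where l: "l \<in> L" "d v u \<le> d v l" "(par ^^ (d v l - d v u)) l = u"
    using leaf_below assms by blast
  with anc_dist[of l "d v l - d v u"] leaf_V have "d u l \<le> d v l - d v u" by auto
  moreover have "d v l \<le> d v u + d u l" using l leaf_V assms by (intro dist_triangle) auto
  ultimately show ?thesis using l that by simp
qed

lemma leaf_stem:
  assumes "l \<in> L"
  obtains x where "{x, l} \<in> E" "\<And>y. {y, l} \<in> E \<Longrightarrow> y = x"
proof -
  obtain x where "nbrs l = {x}" using assms by (auto simp: leaf_iff card_1_singleton_iff)
  with that show ?thesis by (auto simp: nbrs_def)
qed

text \<open>A shortest walk enters the leaf \<open>l\<close> through its only neighbour.\<close>

lemma dist_leaf: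
  assumes "l \<in> L" "{x, l} \<in> E" "v \<in> V" "v \<noteq> l"
  shows "d v l = Suc (d v x)"
proof -
  have "l \<in> V" "d v l \<noteq> 0" using assms dist_eq_0_iff leaf_V by auto
  then obtain n where "d v l = Suc n" using not0_implies_Suc by blast
  with closer_nbr[OF assms(3) \<open>l \<in> V\<close>] obtain y where "{y, l} \<in> E" "d v l = Suc (d v y)"
    by metis
  with assms leaf_stem show ?thesis by metis
qed

lemma edge_dist_leaf:
  assumes "l \<in> L" "{x, l} \<in> E" "v \<in> V"
  shows "edge_dist T v {x, l} = (if v = l then 0 else d v x)"
  using assms dist_leaf[OF assms] by (auto simp: edge_dist_def)

lemma other_leaf:
  assumes "card L \<ge> 3"
  obtains l where "l \<in> L" "l \<noteq> a" "l \<noteq> b"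
proof -
  have "\<not> L \<subseteq> {a, b}"
  proof
    assume "L \<subseteq> {a, b}"
    then have "card L \<le> card {a, b}" by (intro card_mono) auto
    also have "\<dots> \<le> 2" by (simp add: card_insert_if)
    finally show False using assms by simp
  qed
  with that show ?thesis by blast
qed

text \<open>If two leaves were adjacent, each would be farther than the other from a third
  leaf.\<close>

lemma stem_not_leaf:
  assumes "card L \<ge> 3" "l \<in> L" "{x, l} \<in> E"
  shows "x \<notin> L"
proof
  assume "x \<in> L"
  obtain v where v: "v \<in> L" "v \<noteq> x" "v \<noteq> l" using other_leaf assms by blast
  have "{l, x} \<in> E" using assms by (simp add: insert_commute)
  with dist_leaf[of l x v] dist_leaf[of x l v] assms v \<open>x \<in> L\<close> leaf_V show False by simp
qed

text \<open>The edge at \<open>u\<close> has distance 0 from its two ends only, so it separates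
  \<open>u\<close> from every vertex but its neighbour \<open>x\<close>.\<close>

lemma leaf_resolved:
  assumes L3: "card L \<ge> 3" and "u \<in> L" "v \<in> V" "u \<noteq> v"
  obtains l x where "l \<in> L" "{x, l} \<in> E" "edge_dist T u {x, l} \<noteq> edge_dist T v {x, l}"
proof -
  obtain x where x: "{x, u} \<in> E" using leaf_stem assms by blast
  then have "x \<in> V" using adjD by blast
  show ?thesis
  proof (cases "v = x")
    case False
    then have "d v x \<noteq> 0" using \<open>x \<in> V\<close> assms dist_eq_0_iff by blast
    with x assms leaf_V that[of u x] show ?thesis by (simp add: edge_dist_leaf)
  next
    case True
    \<comment> \<open>Walks from \<open>u\<close> start through \<open>v\<close>, so the edge at any
      other leaf is one step nearer to \<open>v\<close> than to \<open>u\<close>.\<close>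
    obtain l where l: "l \<in> L" "l \<noteq> u" "l \<noteq> v" using other_leaf L3 by blast
    obtain y where y: "{y, l} \<in> E" using leaf_stem l by blast
    have "y \<noteq> u" "y \<in> V" using stem_not_leaf[OF L3 l(1) y] assms adjD[OF y] by auto
    then have "d u y = Suc (d v y)"
      using dist_leaf[of u x y] x True assms leaf_V by (simp add: dist_sym)
    with l y assms leaf_V that[of l y] show ?thesis by (simp add: edge_dist_leaf)
  qed
qed

lemma leaf_edges_resolve:
  assumes L3: "card L \<ge> 3" and uv: "u \<in> V" "v \<in> V" "u \<noteq> v"
  obtains l x where "l \<in> L" "{x, l} \<in> E" "edge_dist T u {x, l} \<noteq> edge_dist T v {x, l}"
proof (cases "u \<in> L \<or> v \<in> L")
  case True
  then show ?thesis
  proof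
    assume "u \<in> L"
    then show ?thesis using leaf_resolved[OF L3 _ uv(2,3)] that by blast
  next
    assume "v \<in> L"
    then show ?thesis using leaf_resolved[OF L3 _ uv(1)] uv(3) that by metis
  qed
next
  case False
  \<comment> \<open>The path from \<open>v\<close> to \<open>l\<close> runs through
    \<open>u\<close>, so the edge at \<open>l\<close> is nearer to \<open>u\<close> than to
    \<open>v\<close>.\<close>
  obtain l where l: "l \<in> L" "d v l = d v u + d u l" using leaf_between uv by blast
  obtain x where x: "{x, l} \<in> E" using leaf_stem l by blast
  have "d v u \<noteq> 0" using uv dist_eq_0_iff by blast
  moreover have "u \<noteq> l" "v \<noteq> l" using l False by auto
  ultimately have "d u x \<noteq> d v x"
    using dist_leaf[OF l(1) x] l uv by auto
  with that[OF l(1) x] \<open>u \<noteq> l\<close> \<open>v \<noteq> l\<close> l x uv show ?thesis by (simp add: edge_dist_leaf)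
qed

section \<open>Bounds from colourings with private leaf colours\<close>

lemma edge_color_code_eq_iff:
  "edge_color_code T k c u = edge_color_code T k c v \<longleftrightarrow>
    (\<forall>i\<in>{1..k}. edge_set_dist T u (color_class T c i) = edge_set_dist T v (color_class T c i))"
  by (auto simp: edge_color_code_def)

lemma chromatic_number_le:
  "edge_locating_coloring T k c \<Longrightarrow> edge_locating_chromatic_number T \<le> enat k"
  unfolding edge_locating_chromatic_number_def by (intro INF_lower) auto

text \<open>The class of a leaf edge is a singleton, so the code records the distance to that edge,
  and these distances resolve all vertices. Colours may come from any type.\<close>

lemma chromatic_number_le_private_leaf_colors:
  assumes L3: "card L \<ge> 3"
    and proper: "\<And>e f. e \<in> E \<Longrightarrow> f \<in> E \<Longrightarrow> e \<noteq> f \<Longrightarrow> e \<inter> f \<noteq> {} \<Longrightarrow> c e \<noteq> c f"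
    and uniq: "\<And>l e f. l \<in> L \<Longrightarrow> l \<in> e \<Longrightarrow> e \<in> E \<Longrightarrow> f \<in> E \<Longrightarrow> c f = c e \<Longrightarrow> f = e"
  shows "edge_locating_chromatic_number T \<le> enat (card (c ` E))"
proof -
  let ?k = "card (c ` E)"
  \<comment> \<open>Renumbers the colours that occur as \<open>1, ..., k\<close>, since each of them
    must be used.\<close>
  obtain g where g: "bij_betw g (c ` E) {1..?k}"
    using finite_same_card_bij[of "c ` E" "{1..?k}"] by auto
  have g_eq: "g (c e) = g (c f) \<longleftrightarrow> c e = c f" if "e \<in> E" "f \<in> E" for e f
    using g that by (auto simp: bij_betw_def inj_on_def)
  have image: "(g \<circ> c) ` E = {1..?k}"
    using g by (simp add: bij_betw_def image_comp)
  have "inj_on (edge_color_code T ?k (g \<circ> c)) V"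
  proof (rule inj_onI, rule ccontr)
    fix u v assume uv: "u \<in> V" "v \<in> V" "u \<noteq> v"
      and eq: "edge_color_code T ?k (g \<circ> c) u = edge_color_code T ?k (g \<circ> c) v"
    obtain l x where lx: "l \<in> L" "{x, l} \<in> E" "edge_dist T u {x, l} \<noteq> edge_dist T v {x, l}"
      using leaf_edges_resolve[OF L3 uv] .
    have "c f = c {x, l} \<longleftrightarrow> f = {x, l}" if "f \<in> E" for f
      using uniq[OF lx(1) _ lx(2) that] by auto
    then have "color_class T (g \<circ> c) (g (c {x, l})) = {{x, l}}"
      using lx(2) by (auto simp: color_class_def g_eq)
    moreover have "g (c {x, l}) \<in> {1..?k}" using image lx(2) by auto
    ultimately have "edge_set_dist T u {{x, l}} = edge_set_dist T v {{x, l}}"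
      using eq unfolding edge_color_code_eq_iff by metis
    with lx(3) show False by (simp add: edge_set_dist_def)
  qed
  moreover have "proper_edge_coloring T ?k (g \<circ> c)"
    using image proper by (simp add: proper_edge_coloring_def g_eq)
  ultimately show ?thesis
    by (intro chromatic_number_le[where c = "g \<circ> c"]) (simp add: edge_locating_coloring_def)
qed

end

subsection \<open>Greedy colouring of the inner subtree\<close>

context rooted_tree
begin

abbreviation "inner \<equiv> induced_subgraph T (V - L)"

lemma par_inner:
  assumes "r \<notin> L" "x \<in> V" "x \<noteq> r"
  shows "par x \<in> V - L"
proof (cases "par x = r")
  case False
  have "x \<in> children (par x)" using assms by (simp add: children_def)
  with False assms par_V leaf_iff_children[of "par x"] show ?thesis by auto
qed (use assms root in auto)

text \<open>The count behind the greedy step: away from the root the upward edge uses one of the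
  available colours, and the inner edges downward fit into the remaining ones.\<close>

lemma card_inner_children:
  assumes "r \<notin> L" "v \<in> V - L"
  shows "card (children v - L) + (if v = r then 0 else 1) \<le> max_degree inner"
proof -
  \<comment> \<open>The lower ends of inner edges at \<open>v\<close>, so that \<open>up\<close>
    maps \<open>S\<close> injectively into those edges.\<close>
  define S where "S = (children v - L) \<union> (if v = r then {} else {v})"
  have "v \<notin> children v"
    using par_depth[of v] by (auto simp: children_def)
  then have "card (children v - L) + (if v = r then 0 else 1) = card S"
    by (simp add: S_def)
  also have "\<dots> = card (up ` S)"
    using assms by (intro card_image[symmetric] inj_on_subset[OF inj_on_up])
      (auto simp: S_def children_def)
  also have "\<dots> \<le> card {e \<in> edges inner. v \<in> e}"
  proof (rule card_mono)
    show "finite {e \<in> edges inner. v \<in> e}"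
      by (simp add: induced_subgraph_def)
    show "up ` S \<subseteq> {e \<in> edges inner. v \<in> e}"
    proof clarify
      fix x assume x: "x \<in> S"
      then have x': "x \<in> V - L" "x \<noteq> r"
        using assms by (auto simp: S_def children_def split: if_splits)
      with par_inner[OF assms(1)] have "par x \<in> V - L" by blast
      moreover have "v \<in> up x"
        using x by (auto simp: S_def children_def up_def split: if_splits)
      ultimately show "up x \<in> edges inner \<and> v \<in> up x"
        using x' up_edge[of x] by (simp add: induced_subgraph_def) (simp add: up_def)
    qed
  qed
  also have "\<dots> = vertex_degree inner v" by (simp add: vertex_degree_def)
  also have "\<dots> \<le> max_degree inner"
    unfolding max_degree_def using assms by (intro Max_ge) (auto simp: induced_subgraph_def)
  finally show ?thesis .
qed

text \<open>Here \<open>\<kappa> x\<close> is the colour of the edge \<open>up x\<close>. Colours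
  are assigned downward level by level, all inner children of a vertex at once.\<close>

lemma greedy_coloring:
  assumes r: "r \<notin> L"
  obtains \<kappa> :: "'a \<Rightarrow> nat"
  where "\<And>v. v \<in> V - L \<Longrightarrow> inj_on \<kappa> (children v - L)"
    and "\<And>x. x \<in> V - L \<Longrightarrow> x \<noteq> r \<Longrightarrow> \<kappa> x \<in> {1..max_degree inner}"
    and "\<And>x. x \<in> V - L \<Longrightarrow> x \<noteq> r \<Longrightarrow> \<kappa> x \<noteq> \<kappa> (par x)"
proof -
  let ?D = "max_degree inner"
  \<comment> \<open>\<open>F v a\<close> is a chosen colouring of the inner children of
    \<open>v\<close> that avoids the colour \<open>a\<close> of \<open>v\<close>. \<open>K n\<close>
    colours the vertices of depth \<open>n\<close>, so the recursion runs over natural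
    numbers.\<close>
  define good where "good v a f \<longleftrightarrow>
    inj_on f (children v - L) \<and> f ` (children v - L) \<subseteq> {1..?D} - {a}" for v and a :: nat and f
  define F where "F v a = (SOME f. good v a f)" for v a
  define K where "K = rec_nat (\<lambda>x. 0) (\<lambda>n g x. F (par x) (g (par x)) x)"
  define \<kappa> where "\<kappa> x = K (d r x) x" for x
  have \<kappa>_root: "\<kappa> r = 0" using root by (simp add: \<kappa>_def K_def)
  have \<kappa>_rec: "\<kappa> x = F (par x) (\<kappa> (par x)) x" if "x \<in> V" "x \<noteq> r" for x
    using par_depth[OF that, symmetric] by (simp add: \<kappa>_def K_def)
  \<comment> \<open>The root has colour 0, outside the palette, so it excludes nothing for its children.\<close>
  have good: "good v (\<kappa> v) (F v (\<kappa> v))" if v: "v \<in> V - L" for v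
  proof -
    have "card (children v - L) \<le> card ({1..?D} - {\<kappa> v})"
      using card_inner_children[OF r v] \<kappa>_root by (auto simp: card_Diff_singleton_if split: if_splits)
    then have "\<exists>f. good v (\<kappa> v) f"
      unfolding good_def by (subst inj_on_iff_card_le) auto
    then show ?thesis unfolding F_def by (rule someI_ex)
  qed
  have F_eq: "\<kappa> x = F v (\<kappa> v) x" if "x \<in> children v" for x v
    using that \<kappa>_rec by (auto simp: children_def)
  show ?thesis
  proof (rule that[of \<kappa>])
    show "inj_on \<kappa> (children v - L)" if "v \<in> V - L" for v
      using good[OF that] F_eq by (auto simp: good_def inj_on_def)
    have "\<kappa> x \<in> {1..?D} - {\<kappa> (par x)}" if x: "x \<in> V - L" "x \<noteq> r" for x
    proof -
      have "x \<in> children (par x) - L" using x by (simp add: children_def)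
      with good[of "par x"] par_inner[OF r, of x] x F_eq[of x "par x"] show ?thesis
        unfolding good_def by auto
    qed
    then show "\<kappa> x \<in> {1..?D}" "\<kappa> x \<noteq> \<kappa> (par x)" if "x \<in> V - L" "x \<noteq> r" for x
      using that by blast+
  qed
qed

lemma chromatic_number_le_inner:
  assumes L3: "card L \<ge> 3" and r: "r \<notin> L"
  shows "edge_locating_chromatic_number T \<le> enat (max_degree inner + card L)"
proof -
  obtain \<kappa> :: "'a \<Rightarrow> nat"
    where inj: "\<And>v. v \<in> V - L \<Longrightarrow> inj_on \<kappa> (children v - L)"
      and range: "\<And>x. x \<in> V - L \<Longrightarrow> x \<noteq> r \<Longrightarrow> \<kappa> x \<in> {1..max_degree inner}"
      and vert: "\<And>x. x \<in> V - L \<Longrightarrow> x \<noteq> r \<Longrightarrow> \<kappa> x \<noteq> \<kappa> (par x)"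
    using greedy_coloring[OF r] by blast
  \<comment> \<open>The disjoint sum keeps the private leaf colours apart from the greedy
    palette.\<close>
  define C :: "'a \<Rightarrow> 'a + nat" where "C x = (if x \<in> L then Inl x else Inr (\<kappa> x))" for x
  define c where "c e = C (low e)" for e
  have "edge_locating_chromatic_number T \<le> enat (card (c ` E))"
  proof (rule chromatic_number_le_private_leaf_colors[OF L3])
    fix e f assume ef: "e \<in> E" "f \<in> E" "e \<noteq> f" "e \<inter> f \<noteq> {}"
    show "c e \<noteq> c f"
      unfolding c_def
    proof (rule proper_by_lower_end[OF _ _ ef])
      show "C x \<noteq> C (par x)" if "x \<in> V" "x \<noteq> r" "par x \<noteq> r" for x
        using that vert[of x] par_inner[OF r, of x] by (auto simp: C_def)
      show "inj_on C (children v)" for v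
      proof (cases "children v = {}")
        case False
        then have "v \<in> V - L" using par_inner[OF r] by (auto simp: children_def)
        from inj[OF this] show ?thesis
          by (auto simp: inj_on_def C_def split: if_splits)
      qed simp
    qed
  next
    fix l e f assume l: "l \<in> L" "l \<in> e" "e \<in> E" and f: "f \<in> E" "c f = c e"
    \<comment> \<open>A leaf other than the root has no children, so its only edge is
      \<open>up l\<close>, and the colour \<open>Inl l\<close> occurs on this edge alone.\<close>
    have "l \<noteq> r" using l r by auto
    with l leaf_iff_children[of l] leaf_V have "children l = {}" by blast
    with l(2,3) have "e = up l" by (auto elim: edge_at_cases)
    with f l \<open>l \<noteq> r\<close> leaf_V have "C (low f) = Inl l" by (simp add: c_def C_def)
    then have "low f = l" by (auto simp: C_def split: if_splits)
    with f(1) \<open>e = up l\<close> show "f = e" by (auto elim: edge_upE)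
  qed
  \<comment> \<open>Some palette colours may not occur, hence an inequality only.\<close>
  also have "card (c ` E) \<le> card (Inl ` L \<union> Inr ` {1..max_degree inner} :: ('a + nat) set)"
  proof (intro card_mono subsetI)
    fix y assume "y \<in> c ` E"
    then obtain x where "x \<in> V" "x \<noteq> r" "y = C x" by (auto simp: c_def elim!: edge_upE)
    with range show "y \<in> Inl ` L \<union> Inr ` {1..max_degree inner}" by (auto simp: C_def)
  qed simp
  also have "\<dots> = card L + max_degree inner"
    by (subst card_Un_disjoint) (auto simp: card_image)
  finally show ?thesis by (simp add: add.commute)
qed

end

subsection \<open>Distances to colour classes\<close>

context tree_graph
begin

context
  fixes c :: "'a set \<Rightarrow> nat" and k :: nat
  assumes used: "k \<in> c ` E"
begin

abbreviation "class_dist v \<equiv> edge_set_dist T v (color_class T c k)"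

lemma class_dist_le:
  assumes "e \<in> E" "c e = k" "x \<in> e"
  shows "class_dist v \<le> d v x"
proof -
  have "finite e" using assms(1) by (auto elim: edgeE)
  then have "edge_dist T v e \<le> d v x"
    unfolding edge_dist_def using assms by (intro Min_le) auto
  moreover have "class_dist v \<le> edge_dist T v e"
    unfolding edge_set_dist_def using assms by (intro Min_le) (auto simp: color_class_def)
  ultimately show ?thesis by linarith
qed

text \<open>By \<open>used\<close> the class is nonempty, and both minima range over finite nonempty
  sets.\<close>

lemma class_dist_attained:
  obtains e x where "e \<in> E" "c e = k" "x \<in> e" "class_dist v = d v x"
proof -
  have "class_dist v \<in> edge_dist T v ` color_class T c k"
    unfolding edge_set_dist_def using used by (intro Min_in) (auto simp: color_class_def)
  then obtain e where e: "e \<in> E" "c e = k" "class_dist v = edge_dist T v e"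
    by (auto simp: color_class_def)
  moreover have "edge_dist T v e \<in> d v ` e"
    unfolding edge_dist_def using edgeE[OF e(1)] by (intro Min_in) force+
  ultimately show ?thesis using that by auto
qed

lemma class_dist_0_iff:
  assumes "v \<in> V"
  shows "class_dist v = 0 \<longleftrightarrow> (\<exists>e\<in>E. v \<in> e \<and> c e = k)"
proof
  assume *: "class_dist v = 0"
  obtain e x where e: "e \<in> E" "c e = k" "x \<in> e" "class_dist v = d v x"
    using class_dist_attained .
  from e have "x \<in> V" using simple by (auto simp: finite_simple_graph_def)
  with e * assms dist_eq_0_iff have "v = x" by auto
  with e show "\<exists>e\<in>E. v \<in> e \<and> c e = k" by blast
next
  assume "\<exists>e\<in>E. v \<in> e \<and> c e = k"
  with class_dist_le[of _ v v] assms show "class_dist v = 0" by auto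
qed

lemma class_dist_adj:
  assumes "{u, v} \<in> E"
  shows "class_dist u \<le> Suc (class_dist v)"
proof -
  obtain e x where e: "e \<in> E" "c e = k" "x \<in> e" "class_dist v = d v x"
    using class_dist_attained .
  then have "x \<in> V" using simple by (auto simp: finite_simple_graph_def)
  then have "d u x \<le> d u v + d v x" using adjD[OF assms] by (intro dist_triangle)
  with dist_adj[OF assms] class_dist_le[OF e(1-3), of u] e(4) show ?thesis by simp
qed

end

end

subsection \<open>Spiders\<close>

text \<open>A match with the elements swapped would make \<open>a\<close> and \<open>b\<close>
  successors of each other modulo \<open>m\<close>, which forces \<open>m\<close> to divide
  2.\<close>

lemma cyclic_pair_eq:
  fixes a b m :: nat
  assumes "3 \<le> m" "a < m" "b < m"
    and "{Suc a, Suc (Suc a mod m)} = {Suc b, Suc (Suc b mod m)}"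
  shows "a = b"
  using assms by (auto simp: doubleton_eq_iff mod_Suc split: if_splits)

locale spider = rooted_tree +
  fixes m :: nat
  assumes m3: "m \<ge> 3" and card_leaves: "card L = m" and card_children_root: "card (children r) = m"
begin

lemma root_not_leaf: "r \<notin> L"
  using card_nbrs[OF root] card_children_root m3 by (simp add: leaf_iff)

section \<open>The legs of the spider, each named by its vertex next to the centre\<close>

definition branch :: "'a \<Rightarrow> 'a" where
  "branch x = (par ^^ (d r x - 1)) x"

lemma depth_pos: "x \<in> V \<Longrightarrow> x \<noteq> r \<Longrightarrow> d r x > 0"
  using root dist_eq_0_iff by auto

lemma depth_1_iff:
  assumes "x \<in> V" "x \<noteq> r"
  shows "d r x = 1 \<longleftrightarrow> par x = r"
  using par_depth[OF assms] par_V[OF assms] root dist_eq_0_iff[of r "par x"] by auto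

lemma branch_in:
  assumes "x \<in> V" "x \<noteq> r"
  shows "branch x \<in> children r"
proof -
  have *: "branch x \<in> V" "d r (branch x) = 1"
    using anc_dist[OF assms(1), of "d r x - 1"] depth_pos[OF assms] by (auto simp: branch_def)
  with root have "branch x \<noteq> r" by auto
  with * depth_1_iff show ?thesis by (auto simp: children_def)
qed

lemma branch_par:
  assumes "x \<in> V" "x \<noteq> r" "par x \<noteq> r"
  shows "branch (par x) = branch x"
proof -
  obtain n where n: "d r (par x) = Suc n"
    using depth_pos[of "par x"] par_V assms gr0_implies_Suc by blast
  with par_depth[of x] assms have "d r x = Suc (Suc n)" by simp
  with n show ?thesis by (simp add: branch_def funpow_swap1)
qed

lemma branch_child_root: "x \<in> children r \<Longrightarrow> branch x = x"
  using depth_1_iff[of x] by (auto simp: branch_def children_def)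

text \<open>Every child of the centre has a leaf below it. As there are \<open>m\<close> of each,
  every leg then has exactly one leaf.\<close>

lemma branch_leaves: "branch ` L = children r"
proof
  show "branch ` L \<subseteq> children r"
    using branch_in leaf_V root_not_leaf by (metis image_subsetI)
  show "children r \<subseteq> branch ` L"
  proof
    fix n assume "n \<in> children r"
    then have n: "n \<in> V" "n \<noteq> r" "d r n = 1"
      using depth_1_iff by (auto simp: children_def)
    obtain l where "l \<in> L" "(par ^^ (d r l - d r n)) l = n"
      using leaf_below n by blast
    with n show "n \<in> branch ` L" by (auto simp: branch_def)
  qed
qed

lemma inj_on_branch_leaves: "inj_on branch L"
  by (rule eq_card_imp_inj_on) (simp_all add: branch_leaves card_leaves card_children_root)

text \<open>The legs are paths: \<open>u\<close> and \<open>v\<close> are ancestors of the single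
  leaf of their leg, at the same height above it.\<close>

lemma branch_depth_inj:
  assumes "u \<in> V" "u \<noteq> r" "v \<in> V" "v \<noteq> r" "branch u = branch v" "d r u = d r v"
  shows "u = v"
proof -
  have leaf: "\<exists>l\<in>L. (par ^^ (d r l - d r x)) l = x \<and> branch l = branch x"
    if x: "x \<in> V" "x \<noteq> r" for x
  proof -
    obtain l where l: "l \<in> L" "d r x \<le> d r l" "(par ^^ (d r l - d r x)) l = x"
      using leaf_below x by blast
    \<comment> \<open>The climb from \<open>l\<close> to depth 1 splits at \<open>x\<close>, so
      \<open>l\<close> and \<open>x\<close> lie on the same leg.\<close>
    have "d r l - 1 = (d r x - 1) + (d r l - d r x)" using l depth_pos[OF x] by simp
    then have "branch l = branch x"
      using l(3) by (simp add: branch_def funpow_add)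
    with l show ?thesis by blast
  qed
  obtain l where l: "l \<in> L" "(par ^^ (d r l - d r u)) l = u" "branch l = branch u"
    using leaf[OF assms(1,2)] by blast
  obtain l' where l': "l' \<in> L" "(par ^^ (d r l' - d r v)) l' = v" "branch l' = branch v"
    using leaf[OF assms(3,4)] by blast
  have "l = l'" using inj_onD[OF inj_on_branch_leaves] l(1,3) l'(1,3) assms(5) by simp
  with l(2) l'(2) assms(6) show ?thesis by metis
qed

section \<open>The cyclic colouring of the legs\<close>

definition index :: "'a \<Rightarrow> nat" where
  "index = (SOME h. bij_betw h (children r) {0..<m})"

lemma bij_index: "bij_betw index (children r) {0..<m}"
  unfolding index_def
  using someI_ex[OF ex_bij_betw_finite_nat[OF finite_children[of r]]]
  by (simp add: card_children_root)

text \<open>Indices start at 0 and colours at 1, so the reduction modulo \<open>m\<close> precedes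
  the outer \<open>Suc\<close>.\<close>

definition leg_colors :: "'a \<Rightarrow> nat set" where
  "leg_colors b = {Suc (index b), Suc (Suc (index b) mod m)}"

text \<open>The colour of the edge \<open>up x\<close>. Odd depths take the first colour of the
  pair, so that the edges at the centre carry every colour exactly once.\<close>

definition vcolor :: "'a \<Rightarrow> nat" where
  "vcolor x = (if odd (d r x) then Suc (index (branch x)) else Suc (Suc (index (branch x)) mod m))"

definition ecolor :: "'a set \<Rightarrow> nat" where
  "ecolor e = vcolor (low e)"

abbreviation "code v k \<equiv> edge_set_dist T v (color_class T ecolor k)"

lemma index_less: "b \<in> children r \<Longrightarrow> index b < m"
  using bij_index by (auto simp: bij_betw_def)

lemma leg_colors_inj:
  assumes "b \<in> children r" "b' \<in> children r" "leg_colors b = leg_colors b'"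
  shows "b = b'"
proof -
  have "index b = index b'"
    using cyclic_pair_eq[OF m3] assms index_less unfolding leg_colors_def by blast
  with assms bij_index show ?thesis by (auto simp: bij_betw_def inj_on_def)
qed

lemma leg_colors_neq: "b \<in> children r \<Longrightarrow> Suc (index b) \<noteq> Suc (Suc (index b) mod m)"
  using index_less[of b] m3 by (auto simp: mod_Suc split: if_splits)

lemma card_leg_colors: "b \<in> children r \<Longrightarrow> card (leg_colors b) = 2"
  using leg_colors_neq by (simp add: leg_colors_def)

lemma leg_colors_subset: "b \<in> children r \<Longrightarrow> leg_colors b \<subseteq> {1..m}"
  using index_less[of b] m3 by (auto simp: leg_colors_def mod_Suc)

lemma vcolor_in: "vcolor x \<in> leg_colors (branch x)"
  by (simp add: vcolor_def leg_colors_def)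

lemma vcolor_child_root: "x \<in> children r \<Longrightarrow> vcolor x = Suc (index x)"
  using depth_1_iff[of x] by (auto simp: vcolor_def branch_child_root children_def)

lemma vcolor_range:
  assumes "x \<in> V" "x \<noteq> r"
  shows "vcolor x \<in> {1..m}"
  using vcolor_in leg_colors_subset[OF branch_in[OF assms]] by blast

lemma vcolor_children_root: "vcolor ` children r = {1..m}"
proof -
  have "vcolor ` children r = Suc ` index ` children r"
    by (auto simp: vcolor_child_root image_iff)
  also have "index ` children r = {0..<m}" using bij_index by (simp add: bij_betw_def)
  finally show ?thesis by (simp add: image_Suc_atLeastLessThan atLeastLessThanSuc_atLeastAtMost)
qed

lemma vcolor_par:
  assumes "x \<in> V" "x \<noteq> r" "par x \<noteq> r"
  shows "vcolor x \<noteq> vcolor (par x)" "leg_colors (branch x) = {vcolor x, vcolor (par x)}"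
proof -
  have "even (d r x) \<longleftrightarrow> odd (d r (par x))" using par_depth[of x] assms by (metis even_Suc)
  with leg_colors_neq[OF branch_in[of x]] branch_par[OF assms] assms
  show "vcolor x \<noteq> vcolor (par x)" "leg_colors (branch x) = {vcolor x, vcolor (par x)}"
    by (auto simp: vcolor_def leg_colors_def)
qed

text \<open>Away from the centre a vertex has at most one child.\<close>

lemma inj_on_vcolor_children: "inj_on vcolor (children v)"
proof (rule inj_onI)
  fix x y assume xy: "x \<in> children v" "y \<in> children v" "vcolor x = vcolor y"
  show "x = y"
  proof (cases "v = r")
    case True
    with xy vcolor_child_root bij_index show ?thesis by (auto simp: bij_betw_def inj_on_def)
  next
    case False
    have "branch x = branch y"
      using xy False branch_par[of x] branch_par[of y] by (auto simp: children_def)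
    moreover have "d r x = d r y"
      using xy par_depth[of x] par_depth[of y] by (auto simp: children_def)
    ultimately show ?thesis using xy branch_depth_inj by (auto simp: children_def)
  qed
qed

lemma ecolor_image: "ecolor ` E = {1..m}"
proof -
  have "ecolor ` E = vcolor ` (V - {r})"
    by (auto simp: edges_eq_up ecolor_def image_image)
  moreover have "vcolor ` children r \<subseteq> vcolor ` (V - {r})" by (auto simp: children_def)
  moreover have "vcolor ` (V - {r}) \<subseteq> {1..m}" using vcolor_range by blast
  ultimately show ?thesis using vcolor_children_root by simp
qed

lemma proper: "proper_edge_coloring T m ecolor"
  using ecolor_image proper_by_lower_end[OF vcolor_par(1) inj_on_vcolor_children]
  unfolding proper_edge_coloring_def ecolor_def by blast

section \<open>Codes in the spider\<close>

definition zeros :: "'a \<Rightarrow> nat set" where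
  "zeros v = {k \<in> {1..m}. code v k = 0}"

lemma zeros_eq:
  assumes "v \<in> V"
  shows "zeros v = vcolor ` (children v \<union> ({v} - {r}))"
proof -
  have "code v k = 0 \<longleftrightarrow> k \<in> ecolor ` {e \<in> E. v \<in> e}" if "k \<in> {1..m}" for k
    using class_dist_0_iff[OF _ assms, of k ecolor] that ecolor_image by auto
  moreover have "ecolor ` {e \<in> E. v \<in> e} \<subseteq> {1..m}" using ecolor_image by blast
  ultimately have "zeros v = ecolor ` {e \<in> E. v \<in> e}"
    unfolding zeros_def set_eq_iff mem_Collect_eq by (metis subsetD)
  also have "{e \<in> E. v \<in> e} = up ` (children v \<union> ({v} - {r}))"
    using assms by (auto simp: edges_eq_up up_def children_def)
  also have "ecolor ` \<dots> = vcolor ` (children v \<union> ({v} - {r}))"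
    unfolding image_image ecolor_def using assms by (intro image_cong) (auto simp: children_def)
  finally show ?thesis .
qed

lemma zeros_root: "zeros r = {1..m}"
  using zeros_eq[OF root] vcolor_children_root by simp

lemma zeros_leaf: "v \<in> L \<Longrightarrow> zeros v = {vcolor v}"
  using zeros_eq[of v] leaf_iff_children[of v] root_not_leaf leaf_V by auto

text \<open>The edges from \<open>v\<close> to its child and to its parent carry the two colours of
  the leg.\<close>

lemma zeros_inner:
  assumes "v \<in> V" "v \<noteq> r" "v \<notin> L"
  shows "zeros v = leg_colors (branch v)"
proof -
  have "\<And>x. x \<in> children v \<Longrightarrow> leg_colors (branch v) = {vcolor x, vcolor v}"
    using vcolor_par(2) branch_par assms by (auto simp: children_def)
  moreover have "children v \<noteq> {}" using assms leaf_iff_children by blast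
  ultimately show ?thesis using zeros_eq[of v] assms by auto
qed

text \<open>The colour \<open>k\<close> occurs only on other legs, which are reached through the
  centre, and the centre has an edge of colour \<open>k\<close>.\<close>

lemma code_other_leg:
  assumes v: "v \<in> V" "v \<noteq> r" and k: "k \<in> {1..m}" "k \<notin> leg_colors (branch v)"
  shows "code v k = d r v"
proof (rule antisym)
  have used: "k \<in> ecolor ` E" using k ecolor_image by simp
  have "k \<in> zeros r" using k zeros_root by simp
  then obtain e where "e \<in> E" "r \<in> e" "ecolor e = k"
    using class_dist_0_iff[OF used root] by (auto simp: zeros_def)
  from class_dist_le[OF used this(1,3,2), of v] show "code v k \<le> d r v"
    using v root by (simp add: dist_sym)
  define f :: "'a \<Rightarrow> int" where
    "f x = (if x \<noteq> r \<and> branch x = branch v then int (d r v) - int (d r x)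
            else int (d r v) + int (d r x))" for x
  \<comment> \<open>\<open>f\<close> is the distance to \<open>v\<close>, except below \<open>v\<close>, where it is its negative.\<close>
  have f_par: "\<bar>f x - f (par x)\<bar> \<le> 1" if "x \<in> V" "x \<noteq> r" for x
    using par_depth[OF that] branch_par[OF that] root by (cases "par x = r") (auto simp: f_def)
  have "f y \<le> f x + 1" if "{x, y} \<in> E" for x y
    using that by (cases rule: adj_cases) (use adjD[OF that] f_par in fastforce)+
  then have lower: "f x \<le> int (d v x)" if "x \<in> V" for x
    using lipschitz_le_dist[of f v x] v that by (simp add: f_def)
  obtain e y where e: "e \<in> E" "ecolor e = k" "y \<in> e" "code v k = d v y"
    using class_dist_attained[OF used] .
  from e(1) obtain x where x: "x \<in> V" "x \<noteq> r" "e = up x" "low e = x" by (rule edge_upE)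
  \<comment> \<open>Both ends of an edge of colour \<open>k\<close> are the centre or lie off the
    leg of \<open>v\<close>; there \<open>f\<close> is at least \<open>d r v\<close>.\<close>
  have "branch x \<noteq> branch v"
    using vcolor_in[of x] x(4) e(2) k(2) by (auto simp: ecolor_def)
  with x e(3) branch_par[of x] par_V[of x] have "y \<in> V" "y = r \<or> branch y \<noteq> branch v"
    by (auto simp: up_def)
  with lower[of y] e(4) show "d r v \<le> code v k" by (auto simp: f_def)
qed

text \<open>A leaf meets a single colour, so \<open>zeros\<close> does not reveal its leg; the
  entries 1 supply the other colour.\<close>

definition near :: "'a \<Rightarrow> nat set" where
  "near v = {k \<in> {1..m}. code v k \<le> 1}"

lemma near_depth_1:
  assumes "v \<in> V" "v \<noteq> r" "d r v = 1"
  shows "near v = {1..m}"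
proof -
  have "{v, r} \<in> E"
    using par_edge[of v] depth_1_iff[of v] assms by (simp add: insert_commute)
  moreover have "code r k = 0" if "k \<in> {1..m}" for k
    using that zeros_root unfolding zeros_def by blast
  ultimately have "code v k \<le> 1" if "k \<in> {1..m}" for k
    using class_dist_adj[of k ecolor v r] that ecolor_image by simp
  then show ?thesis by (auto simp: near_def)
qed

text \<open>The parent is neither the centre nor a leaf, so it meets both colours of the leg. All
  other colours are at distance \<open>d r v\<close>, which is at least 2.\<close>

lemma near_deeper:
  assumes v: "v \<in> V" "v \<noteq> r" "d r v \<noteq> 1"
  shows "near v = leg_colors (branch v)"
proof -
  note b = branch_in[OF v(1,2)]
  have far: "k \<notin> near v" if "k \<in> {1..m}" "k \<notin> leg_colors (branch v)" for k
    using code_other_leg[OF v(1,2) that] depth_pos[OF v(1,2)] v(3) by (simp add: near_def)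
  have "par v \<noteq> r" using depth_1_iff v by blast
  have "v \<in> children (par v)" using v by (simp add: children_def)
  then have "par v \<notin> L" using leaf_iff_children[of "par v"] par_V[of v] v \<open>par v \<noteq> r\<close> by auto
  then have zeros: "zeros (par v) = leg_colors (branch v)"
    using zeros_inner[of "par v"] par_V[of v] branch_par[of v] v \<open>par v \<noteq> r\<close> by simp
  have "{v, par v} \<in> E" using par_edge[of v] v by (simp add: insert_commute)
  moreover have "k \<in> {1..m} \<and> code (par v) k = 0" if "k \<in> leg_colors (branch v)" for k
    using that unfolding zeros[symmetric] zeros_def by blast
  ultimately have "code v k \<le> 1" if "k \<in> leg_colors (branch v)" for k
    using class_dist_adj[of k ecolor v "par v"] that ecolor_image by simp
  with far leg_colors_subset[OF b] show ?thesis by (auto simp: near_def)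
qed

lemma card_zeros:
  assumes "v \<in> V" "v \<noteq> r"
  shows "card (zeros v) = (if v \<in> L then 1 else 2)"
  using assms by (simp add: zeros_leaf zeros_inner card_leg_colors branch_in)

lemma branch_determined:
  assumes u: "u \<in> V" "u \<noteq> r" and v: "v \<in> V" "v \<noteq> r"
    and eq: "zeros u = zeros v" "near u = near v"
  shows "branch u = branch v"
proof -
  have "card (zeros u) = card (zeros v)" using eq(1) by simp
  then have L_iff: "u \<in> L \<longleftrightarrow> v \<in> L"
    unfolding card_zeros[OF u] card_zeros[OF v] by (simp split: if_splits)
  show ?thesis
  proof (cases "v \<in> L")
    case False
    with L_iff have "u \<notin> L" by simp
    with False eq(1) have "leg_colors (branch u) = leg_colors (branch v)"
      by (simp add: zeros_inner[OF u] zeros_inner[OF v])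
    then show ?thesis by (rule leg_colors_inj[OF branch_in[OF u] branch_in[OF v]])
  next
    case True
    with L_iff have "u \<in> L" by simp
    have card_near: "card (near x) = (if d r x = 1 then m else 2)" if "x \<in> V" "x \<noteq> r" for x
      using that by (simp add: near_depth_1 near_deeper card_leg_colors branch_in)
    have "card (near u) = card (near v)" using eq(2) by simp
    \<comment> \<open>As \<open>m \<ge> 3\<close>, the size of \<open>near\<close> tells depth 1
      from larger depths.\<close>
    then have "d r u = 1 \<longleftrightarrow> d r v = 1"
      unfolding card_near[OF u] card_near[OF v] using m3 by (simp split: if_splits)
    then consider "d r u = 1" "d r v = 1" | "d r u \<noteq> 1" "d r v \<noteq> 1" by blast
    then show ?thesis
    proof cases
      case 1
      then have ch: "u \<in> children r" "v \<in> children r"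
        using u v depth_1_iff by (auto simp: children_def)
      \<comment> \<open>Leaves next to the centre are told apart by the colours of their
        edges.\<close>
      have "vcolor u = vcolor v" using zeros_leaf[OF True] zeros_leaf[OF \<open>u \<in> L\<close>] eq by simp
      with ch have "u = v" by (intro inj_onD[OF inj_on_vcolor_children])
      then show ?thesis by simp
    next
      case 2
      with eq(2) have "leg_colors (branch u) = leg_colors (branch v)"
        by (simp add: near_deeper[OF u] near_deeper[OF v])
      then show ?thesis by (rule leg_colors_inj[OF branch_in[OF u] branch_in[OF v]])
    qed
  qed
qed

lemma locating: "edge_locating_coloring T m ecolor"
proof -
  have "u = v" if u: "u \<in> V" and v: "v \<in> V" and code: "\<forall>k\<in>{1..m}. code u k = code v k" for u v
  proof -
    have eq: "zeros u = zeros v" "near u = near v" using code by (auto simp: zeros_def near_def)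
    \<comment> \<open>The centre meets \<open>m \<ge> 3\<close> colours, every other vertex at most
      2.\<close>
    have "x = r \<longleftrightarrow> card (zeros x) = m" if "x \<in> V" for x
      using zeros_root card_zeros[OF that] m3 by (cases "x = r") auto
    with u v eq(1) have "u = r \<longleftrightarrow> v = r" by simp
    moreover have "u = v" if "u \<noteq> r" "v \<noteq> r"
    proof -
      have b: "branch u = branch v" using branch_determined u v that eq by blast
      \<comment> \<open>A third colour exists, and its entry is the depth, which fixes the position
        on the leg.\<close>
      have "\<not> {1..m} \<subseteq> leg_colors (branch v)"
        using card_mono[of "leg_colors (branch v)" "{1..m}"] m3
          card_leg_colors[OF branch_in[OF v that(2)]] by (auto simp: leg_colors_def)
      then obtain k where "k \<in> {1..m}" "k \<notin> leg_colors (branch v)" by blast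
      with code_other_leg[of u k] code_other_leg[of v k] b code u v that
      have "d r u = d r v" by auto
      with b branch_depth_inj u v that show ?thesis by blast
    qed
    ultimately show ?thesis by blast
  qed
  with proper show ?thesis
    unfolding edge_locating_coloring_def inj_on_def edge_color_code_eq_iff by blast
qed

end

section \<open>Lower bound by the degree, and the two cases of the theorem\<close>

lemma (in tree_graph) degree_le_chromatic_number:
  "enat (vertex_degree T v) \<le> edge_locating_chromatic_number T"
  unfolding edge_locating_chromatic_number_def
proof (rule INF_greatest)
  fix k assume "k \<in> {k. \<exists>c. edge_locating_coloring T k c}"
  then obtain c where c: "proper_edge_coloring T k c"
    by (auto simp: edge_locating_coloring_def)
  have "vertex_degree T v \<le> card {1..k}"
    unfolding vertex_degree_def
  proof (rule card_inj_on_le)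
    show "inj_on c {e \<in> E. v \<in> e}"
      using c unfolding proper_edge_coloring_def inj_on_def by blast
    show "c ` {e \<in> E. v \<in> e} \<subseteq> {1..k}"
      using c unfolding proper_edge_coloring_def by blast
  qed simp
  then show "enat (vertex_degree T v) \<le> enat k" by simp
qed

theorem theorem23:
  fixes T :: "'a ugraph" and m :: nat
  assumes "finite_tree T"
    and "card (leaf_set T) = m"
    and "m \<ge> 3"
  shows "(max_degree T = m \<longrightarrow> edge_locating_chromatic_number T = enat m) \<and>
         (max_degree T < m \<longrightarrow>
            edge_locating_chromatic_number T
              \<le> enat (max_degree (induced_subgraph T (vertices T - leaf_set T)) + m))"
proof (intro conjI impI)
  interpret tree_graph T by unfold_locales (rule assms)
  {
    assume "max_degree T = m"
    moreover have "V \<noteq> {}" using connected by (simp add: connected_graph_def)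
    then have "max_degree T \<in> vertex_degree T ` V"
      unfolding max_degree_def by (intro Max_in) auto
    ultimately obtain r where r: "r \<in> V" "vertex_degree T r = m" by auto
    interpret rooted_tree T r by unfold_locales (rule r)
    \<comment> \<open>The root has no parent, so its degree counts its children.\<close>
    interpret spider T r m
      using r assms card_nbrs[of r] by unfold_locales (auto simp: vertex_degree_nbrs)
    show "edge_locating_chromatic_number T = enat m"
      using chromatic_number_le[OF locating] degree_le_chromatic_number[of r] r by simp
  next
    assume "max_degree T < m"
    have L3: "card L \<ge> 3" using assms by simp
    \<comment> \<open>The neighbour of a leaf serves as root, because it is not a leaf
      itself.\<close>
    obtain l where l: "l \<in> L" using other_leaf[OF L3] by blast
    obtain r where rl: "{r, l} \<in> E" using leaf_stem[OF l] by blast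
    then interpret rooted_tree T r by unfold_locales (rule adjD)
    show "edge_locating_chromatic_number T
        \<le> enat (max_degree (induced_subgraph T (V - L)) + m)"
      using chromatic_number_le_inner[OF L3 stem_not_leaf[OF L3 l rl]] assms by simp
  }
qed

end
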